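(* Let $\ell\ge 1$, let $p_1,\dots,p_\ell$ and $c_0,\dots,c_{\ell-1}$ be constants, and let $(a_n)_{n\ge 0}$ be the sequence with $a_j=c_j$ for $0\le j\le \ell-1$ and $a_n=\sum_{j=1}^{\ell}p_j a_{n-j}$ for all $n\ge \ell$. Let $\mathcal{A}_\ell(x)=\sum_{n\ge 0}a_n^2x^n$. Then $$\mathcal{A}_\ell(x)=\frac{\det(\Gamma_\ell)}{x\det(\Delta_\ell)},$$ where $\Delta_\ell$ and $\Gamma_\ell$ are the $\ell\times\ell$ matrices, with rows and columns indexed by $0,\dots,\ell-1$, defined in the context.
   Context: Constants are taken in a field such as $\mathbb{C}$, and generating functions are formal power series in $x$. Conventions: $p_i=0$ for $i\le 0$ (so any term $p_{i-j}x^{i-j}$ with $j\ge i$ is $0$); $\delta_{i,j}$ is the Kronecker delta. For $1\le j\le \ell-1$, $$v_j=p_1p_{j+1}+p_2p_{j+2}x+\cdots+p_{\ell-j}p_\ell x^{\ell-j-1}=\sum_{s=1}^{\ell-j}p_sp_{s+j}x^{s-1}.$$ For $0\le j\le \ell-2$, $$w_j=p_1c_j+p_2c_{j-1}+\cdots+p_{j+1}c_0=\sum_{s=1}^{j+1}p_sc_{j+1-s},$$ and $w_{-1}=0$. The matrix $\Delta_\ell=(\Delta_\ell(i,j))_{0\le i,j\le \ell-1}$ is given by $$\Delta_\ell(i,j)=\begin{cases} 1-\sum_{s=1}^{\ell}p_s^2x^s, & i=j=0,\\ -2xv_j, & i=0 \text{ and } 1\le j\le \ell-1,\\ -p_ix^i,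 & 1\le i\le \ell-1 \text{ and } j=0,\\ \delta_{i,j}-p_{i-j}x^{i-j}-p_{i+j}x^i, & 1\le i\le \ell-1 \text{ and } 1\le j\le \ell-i,\\ \delta_{i,j}, & 1\le i\le \ell-1 \text{ and } \ell+1-i\le j\le \ell-1. \end{cases}$$ The matrix $\Gamma_\ell=(\Gamma_\ell(i,j))_{0\le i,j\le \ell-1}$ is given by $$\Gamma_\ell(i,j)=\begin{cases} x\sum_{s=0}^{\ell-1}(c_s^2-w_{s-1}^2)x^s, & i=j=0,\\ x^{i+1}\sum_{s=0}^{\ell-1-i}c_s(c_{s+i}-w_{s+i-1})x^s, & j=0 \text{ and } 1\le i\le \ell-1,\\ \Delta_\ell(i,j), & 0\le i\le \ell-1 \text{ and } 1\le j\le \ell-1. \end{cases}$$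
   Formalization: In the last case of Δ_ℓ(i,j) (ℓ+1−i ≤ j ≤ ℓ−1) the entry δ_{i,j} is corrected to δ_{i,j} − p_{i−j}x^{i−j}, also in Γ_ℓ; as printed the identity fails, e.g. for ℓ=4, p=(1,0,0,1), c=(1,0,0,0). *)

theory Defs
  imports
    "Jordan_Normal_Form.Determinant"
    "HOL-Computational_Algebra.Formal_Laurent_Series"
begin

text \<open>
  The constants \<open>p\<^sub>1, \<dots>, p\<^sub>l\<close> and \<open>c\<^sub>0, \<dots>, c\<^bsub>l-1\<^esub>\<close> are given by functions on \<open>nat\<close>; values of
  \<open>p\<close> outside \<open>{1..l}\<close> and of \<open>c\<close> outside \<open>{0..<l}\<close> are arbitrary and never enter the matrices below.
\<close>

definition v_poly :: "nat \<Rightarrow> (nat \<Rightarrow> 'a::field) \<Rightarrow> nat \<Rightarrow> 'a fps" where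
  "v_poly l p j = (\<Sum>s = 1..l - j. fps_const (p s * p (s + j)) * fps_X ^ (s - 1))"

text \<open>The index is an integer so that \<open>w\<^bsub>-1\<^esub> = 0\<close> can be stated.\<close>

definition w_coeff :: "(nat \<Rightarrow> 'a::field) \<Rightarrow> (nat \<Rightarrow> 'a) \<Rightarrow> int \<Rightarrow> 'a" where
  "w_coeff p c j =
     (if j < 0 then 0 else (\<Sum>s = 1..nat j + 1. p s * c (nat j + 1 - s)))"

text \<open>
  The guard \<open>j < i\<close> implements the convention \<open>p\<^sub>k = 0\<close> for \<open>k \<le> 0\<close>: without it, truncated
  subtraction would turn \<open>p\<^bsub>i-j\<^esub> x\<^bsup>i-j\<^esup>\<close> into \<open>p 0\<close> for \<open>j \<ge> i\<close>.

  Erratum: the source gives just \<open>\<delta>\<^bsub>i,j\<^esub>\<close> in the last case (\<open>1 \<le> i\<close>, \<open>l + 1 - i \<le> j\<close>), omitting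
  \<open>- p\<^bsub>i-j\<^esub> x\<^bsup>i-j\<^esup>\<close>. This entry is the coefficient of \<open>\<Sum>n. a\<^sub>n a\<^bsub>n+j\<^esub> x\<^bsup>n+j\<^esup>\<close> in the linear system
  obtained from the recurrence; there \<open>p\<^bsub>i+j\<^esub>\<close> drops out for \<open>i + j > l\<close>, but \<open>p\<^bsub>i-j\<^esub>\<close> does not.
  The two versions agree for \<open>l \<le> 3\<close>; for \<open>l = 4\<close>, \<open>p = (1,0,0,1)\<close>, \<open>c = (1,0,0,0)\<close> the identity
  fails without the term.
\<close>

definition Delta_entry :: "nat \<Rightarrow> (nat \<Rightarrow> 'a::field) \<Rightarrow> nat \<Rightarrow> nat \<Rightarrow> 'a fps" where
  "Delta_entry l p i j =
     (if i = 0 \<and> j = 0 then 1 - (\<Sum>s = 1..l. fps_const ((p s)\<^sup>2) * fps_X ^ s)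
      else if i = 0 then - 2 * fps_X * v_poly l p j
      else if j = 0 then - (fps_const (p i) * fps_X ^ i)
      else if j \<le> l - i then
        (if i = j then 1 else 0)
        - (if j < i then fps_const (p (i - j)) * fps_X ^ (i - j) else 0)
        - fps_const (p (i + j)) * fps_X ^ i
      else
        (if i = j then 1 else 0)
        - (if j < i then fps_const (p (i - j)) * fps_X ^ (i - j) else 0))"

definition Delta_mat :: "nat \<Rightarrow> (nat \<Rightarrow> 'a::field) \<Rightarrow> 'a fps mat" where
  "Delta_mat l p = mat l l (\<lambda>(i, j). Delta_entry l p i j)"

definition Gamma_entry ::
    "nat \<Rightarrow> (nat \<Rightarrow> 'a::field) \<Rightarrow> (nat \<Rightarrow> 'a) \<Rightarrow> nat \<Rightarrow> nat \<Rightarrow> 'a fps" where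
  "Gamma_entry l p c i j =
     (if i = 0 \<and> j = 0 then
        fps_X * (\<Sum>s = 0..l - 1. fps_const ((c s)\<^sup>2 - (w_coeff p c (int s - 1))\<^sup>2) * fps_X ^ s)
      else if j = 0 then
        fps_X ^ (i + 1) *
          (\<Sum>s = 0..l - 1 - i.
             fps_const (c s * (c (s + i) - w_coeff p c (int s + int i - 1))) * fps_X ^ s)
      else Delta_entry l p i j)"

definition Gamma_mat :: "nat \<Rightarrow> (nat \<Rightarrow> 'a::field) \<Rightarrow> (nat \<Rightarrow> 'a) \<Rightarrow> 'a fps mat" where
  "Gamma_mat l p c = mat l l (\<lambda>(i, j). Gamma_entry l p c i j)"

end

theory Submission 
  imports Defs
begin

text \<open>
  The matrix \<open>\<Delta>\<close> is the coefficient matrix of a linear system satisfied by the correlation series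
  \<open>u\<^sub>j = \<Sum>n. a\<^sub>n a\<^bsub>n+j\<^esub> x\<^bsup>n+j\<^esup>\<close> for \<open>0 \<le> j < l\<close>, and \<open>u\<^sub>0\<close> is the series to be determined.

  Extend \<open>a\<close> by zero to negative indices and let \<open>r\<^sub>n = \<Sum>s. p\<^sub>s a\<^bsub>n-s\<^esub>\<close> be the value that the recurrence
  predicts at \<open>n\<close>. The prediction is right for \<open>n \<ge> l\<close>, while for \<open>n < l\<close> it equals \<open>w\<^bsub>n-1\<^esub>\<close>
  (lemma \<open>predict\<close>). Therefore \<open>\<Sum>n. (a\<^sub>n\<^sup>2 - r\<^sub>n\<^sup>2) x\<^sup>n\<close> and, for \<open>i \<ge> 1\<close>,
  \<open>\<Sum>n. a\<^bsub>n-i\<^esub> (a\<^sub>n - r\<^sub>n) x\<^sup>n\<close> are polynomials; these are the entries of column 0 of \<open>\<Gamma>\<close>, divided by \<open>x\<close>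
  (lemmas \<open>residual_square\<close> and \<open>residual_product\<close>).

  The same two series can be expanded in products of two delayed copies of \<open>a\<close>. A common
  delay by \<open>s\<close> only contributes a factor \<open>x\<^sup>s\<close> (lemma \<open>corr_shift\<close>), so each such product is a power of
  \<open>x\<close> times some \<open>u\<^sub>j\<close>, and collecting the coefficients of \<open>u\<^sub>j\<close> gives the rows of \<open>\<Delta>\<close> (lemmas
  \<open>Delta_row_0\<close> and \<open>Delta_row_pos\<close>). Altogether \<open>\<Delta> (x u)\<close> is column 0 of \<open>\<Gamma>\<close>; as the other columns
  of \<open>\<Gamma>\<close> are those of \<open>\<Delta>\<close>, Cramer's rule says \<open>det \<Gamma> = x u\<^sub>0 det \<Delta>\<close>. Finally \<open>\<Delta>\<close> reduces to the
  identity matrix at \<open>x = 0\<close>, so \<open>det \<Delta>\<close> has constant term 1 and may be divided by.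
\<close>

definition delayed :: "(nat \<Rightarrow> 'a::field) \<Rightarrow> nat \<Rightarrow> nat \<Rightarrow> 'a" where
  "delayed a s n = (if s \<le> n then a (n - s) else 0)"

text \<open>
  The unknown \<open>u\<^sub>j\<close> of the linear system is \<open>corr a 0 j\<close>. The general form, with both factors delayed,
  makes products of two predictions expand bilinearly.
\<close>

definition corr :: "(nat \<Rightarrow> 'a::field) \<Rightarrow> nat \<Rightarrow> nat \<Rightarrow> 'a fps" where
  "corr a s t = Abs_fps (\<lambda>n. delayed a s n * delayed a t n)"

lemma corr_commute: "corr a s t = corr a t s"
  by (simp add: corr_def mult.commute)

text \<open>Delaying both factors by \<open>s\<close> delays the product by \<open>s\<close>; only the difference of delays matters.\<close>

lemma corr_shift: "corr a s (s + j) = fps_X ^ s * corr a 0 j"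
  by (rule fps_ext) (auto simp: corr_def delayed_def fps_X_power_mult_nth)

lemma corr_self: "corr a s s = fps_X ^ s * corr a 0 0"
  by (metis corr_shift add_0_right)

lemma w_coeff_pred: "w_coeff p c (int n - 1) = (\<Sum>s = 1..n. p s * c (n - s))"
  by (cases n) (simp_all add: w_coeff_def)

lemma fps_monom_sum_nth:
  "(\<Sum>s = 0..m. fps_const (f s) * fps_X ^ s) $ n = (if n \<le> m then f n else 0)"
  by (simp add: fps_sum_nth if_distrib cong: if_cong)

text \<open>
  The off-diagonal part of a symmetric double sum is collected along the diagonals \<open>t - s = j\<close>,
  because \<open>corr a s (s + j)\<close> is a multiple of \<open>u\<^sub>j\<close>. This is the origin of \<open>v\<^sub>j\<close> and of the factor 2.
\<close>

lemma sum_square_split: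
  fixes q :: "nat \<Rightarrow> 'b::comm_ring_1"
  assumes sym: "\<And>s t. C s t = C t s"
  shows "(\<Sum>s = 1..l. \<Sum>t = 1..l. q s * q t * C s t) =
    (\<Sum>s = 1..l. (q s)\<^sup>2 * C s s) + 2 * (\<Sum>j = 1..<l. \<Sum>s = 1..l - j. q s * q (s + j) * C s (s + j))"
proof (induction l)
  case (Suc l)
  let ?g = "\<lambda>j s. q s * q (s + j) * C s (s + j)"
  \<comment> \<open>Each diagonal gains exactly one term, the one with \<open>t = l + 1\<close>; together they form a new column.\<close>
  have "(\<Sum>j = 1..<Suc l. \<Sum>s = 1..Suc l - j. ?g j s) =
     (\<Sum>j = 1..<Suc l. (\<Sum>s = 1..l - j. ?g j s) + q (Suc l - j) * q (Suc l) * C (Suc l - j) (Suc l))"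
    by (intro sum.cong refl) (simp add: Suc_diff_le)
  also have "\<dots> = (\<Sum>j = 1..<l. \<Sum>s = 1..l - j. ?g j s)
      + (\<Sum>j = 1..<Suc l. q (Suc l - j) * q (Suc l) * C (Suc l - j) (Suc l))"
    by (cases l) (simp_all add: sum.distrib)
  also have "(\<Sum>j = 1..<Suc l. q (Suc l - j) * q (Suc l) * C (Suc l - j) (Suc l))
      = (\<Sum>s = 1..l. q s * q (Suc l) * C s (Suc l))"
    by (rule sum.reindex_bij_witness[of _ "\<lambda>s. Suc l - s" "\<lambda>j. Suc l - j"]) auto
  finally have *: "(\<Sum>j = 1..<Suc l. \<Sum>s = 1..Suc l - j. ?g j s) =
     (\<Sum>j = 1..<l. \<Sum>s = 1..l - j. ?g j s) + (\<Sum>s = 1..l. q s * q (Suc l) * C s (Suc l))" .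
  have "(\<Sum>t = 1..l. q (Suc l) * q t * C (Suc l) t) = (\<Sum>s = 1..l. q s * q (Suc l) * C s (Suc l))"
    by (intro sum.cong refl) (simp add: sym[of "Suc l"] mult.commute)
  then have "(\<Sum>s = 1..Suc l. \<Sum>t = 1..Suc l. q s * q t * C s t) =
      (\<Sum>s = 1..l. \<Sum>t = 1..l. q s * q t * C s t) + (q (Suc l))\<^sup>2 * C (Suc l) (Suc l)
      + 2 * (\<Sum>s = 1..l. q s * q (Suc l) * C s (Suc l))"
    by (simp add: sum.distrib power2_eq_square)
  then show ?case
    unfolding * Suc.IH by (simp add: distrib_left)
qed simp

text \<open>Every entry of \<open>\<Delta> - 1\<close> is divisible by \<open>x\<close>, and taking the constant term is a ring homomorphism.\<close>

lemma det_Delta_nth_0: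
  assumes "l \<ge> 1" shows "det (Delta_mat l p) $ 0 = (1 :: 'a :: field)"
proof -
  interpret h: comm_ring_hom "\<lambda>f::'a fps. f $ 0"
    by unfold_locales auto
  have "map_mat (\<lambda>f. f $ 0) (Delta_mat l p) = 1\<^sub>m l"
    by (rule eq_matI) (auto simp: Delta_mat_def Delta_entry_def fps_sum_nth)
  then show ?thesis using h.hom_det[of "Delta_mat l p"] by simp
qed

context
  fixes l :: nat and p c a :: "nat \<Rightarrow> 'a::field"
  assumes l: "l \<ge> 1"
    and init: "\<And>j. j < l \<Longrightarrow> a j = c j"
    and rec: "\<And>n. n \<ge> l \<Longrightarrow> a n = (\<Sum>j = 1..l. p j * a (n - j))"
begin

lemma predict:
  "(\<Sum>s = 1..l. p s * delayed a s n) = (if n < l then w_coeff p c (int n - 1) else a n)"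
proof (cases "n < l")
  case True
  have "(\<Sum>s = 1..l. p s * delayed a s n) = (\<Sum>s = 1..n. p s * c (n - s))"
    using True by (intro sum.mono_neutral_cong_right) (auto simp: delayed_def init)
  with True show ?thesis by (simp add: w_coeff_pred)
next
  case False
  then show ?thesis by (simp add: rec delayed_def)
qed

text \<open>
  The double sum is \<open>\<Sum>n. r\<^sub>n\<^sup>2 x\<^sup>n\<close> for the predictions \<open>r\<^sub>n\<close>, so only coefficients below \<open>l\<close> remain.
\<close>

lemma residual_square:
  "corr a 0 0 - (\<Sum>s = 1..l. \<Sum>t = 1..l. fps_const (p s) * fps_const (p t) * corr a s t)
   = (\<Sum>s = 0..l - 1. fps_const ((c s)\<^sup>2 - (w_coeff p c (int s - 1))\<^sup>2) * fps_X ^ s)"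
proof (rule fps_ext)
  fix n
  have "(\<Sum>s = 1..l. \<Sum>t = 1..l. fps_const (p s) * fps_const (p t) * corr a s t) $ n
    = (\<Sum>s = 1..l. p s * delayed a s n)\<^sup>2"
    by (simp add: fps_sum_nth corr_def power2_eq_square sum_product mult_ac
        flip: fps_const_mult)
  then show "(corr a 0 0 - (\<Sum>s = 1..l. \<Sum>t = 1..l. fps_const (p s) * fps_const (p t) * corr a s t)) $ n =
     (\<Sum>s = 0..l - 1. fps_const ((c s)\<^sup>2 - (w_coeff p c (int s - 1))\<^sup>2) * fps_X ^ s) $ n"
    using l init[of n] unfolding fps_monom_sum_nth fps_sub_nth predict
    by (auto simp: corr_def delayed_def power2_eq_square)
qed

text \<open>
  The left-hand side is \<open>\<Sum>n. a\<^bsub>n-i\<^esub> (a\<^sub>n - r\<^sub>n) x\<^sup>n\<close>: the delay kills the coefficients below \<open>i\<close>, and the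
  correctness of the prediction those from \<open>l\<close> on.
\<close>

lemma residual_product:
  assumes "1 \<le> i" "i < l"
  shows "corr a 0 i - (\<Sum>s = 1..l. fps_const (p s) * corr a i s)
   = fps_X ^ i * (\<Sum>s = 0..l - 1 - i. fps_const (c s * (c (s + i) - w_coeff p c (int s + int i - 1))) * fps_X ^ s)"
proof (rule fps_ext)
  fix n
  have "(\<Sum>s = 1..l. fps_const (p s) * corr a i s) $ n
    = delayed a i n * (\<Sum>s = 1..l. p s * delayed a s n)"
    by (simp add: fps_sum_nth corr_def sum_distrib_left mult_ac)
  then show "(corr a 0 i - (\<Sum>s = 1..l. fps_const (p s) * corr a i s)) $ n =
     (fps_X ^ i * (\<Sum>s = 0..l - 1 - i. fps_const (c s * (c (s + i) - w_coeff p c (int s + int i - 1))) * fps_X ^ s)) $ n"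
    using assms init[of n] init[of "n - i"] unfolding fps_X_power_mult_nth fps_monom_sum_nth fps_sub_nth predict
    by (auto simp: corr_def delayed_def algebra_simps of_nat_diff)
qed

end

lemma Delta_row_0:
  assumes "l \<ge> 1"
  shows "(\<Sum>j = 0..<l. Delta_entry l p 0 j * corr a 0 j) =
    corr a 0 0 - (\<Sum>s = 1..l. \<Sum>t = 1..l. fps_const (p s) * fps_const (p t) * corr a s t)"
proof -
  have v: "(\<Sum>s = 1..l - j. fps_const (p s) * fps_const (p (s + j)) * corr a s (s + j))
      = fps_X * v_poly l p j * corr a 0 j" for j
    unfolding v_poly_def sum_distrib_left sum_distrib_right
    by (intro sum.cong refl) (auto simp: corr_shift mult_ac power_eq_if simp flip: fps_const_mult)
  have "(\<Sum>j = 0..<l. Delta_entry l p 0 j * corr a 0 j) =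
     (1 - (\<Sum>s = 1..l. fps_const ((p s)\<^sup>2) * fps_X ^ s)) * corr a 0 0
     + (\<Sum>j = 1..<l. - 2 * fps_X * v_poly l p j * corr a 0 j)"
    using assms by (simp add: sum.atLeast_Suc_lessThan Delta_entry_def)
  also have "\<dots> = corr a 0 0 - ((\<Sum>s = 1..l. (fps_const (p s))\<^sup>2 * corr a s s)
     + 2 * (\<Sum>j = 1..<l. fps_X * v_poly l p j * corr a 0 j))"
  proof -
    have "(\<Sum>s = 1..l. (fps_const (p s))\<^sup>2 * corr a s s)
        = (\<Sum>s = 1..l. fps_const ((p s)\<^sup>2) * fps_X ^ s) * corr a 0 0"
      unfolding sum_distrib_right
      by (intro sum.cong refl) (subst corr_self, simp add: mult.assoc)
    then show ?thesis
      by (simp add: algebra_simps sum_distrib_left sum_negf)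
  qed
  finally show ?thesis
    unfolding sum_square_split[where C = "corr a", OF corr_commute] v .
qed

text \<open>
  The terms \<open>p\<^sub>s corr a i s\<close> with \<open>s < i\<close>, \<open>s = i\<close> and \<open>s > i\<close> are multiples of \<open>u\<^bsub>i-s\<^esub>\<close>, \<open>u\<^sub>0\<close> and \<open>u\<^bsub>s-i\<^esub>\<close>.
  They give the entries \<open>p\<^bsub>i-j\<^esub> x\<^bsup>i-j\<^esup>\<close>, \<open>p\<^sub>i x\<^sup>i\<close> and \<open>p\<^bsub>i+j\<^esub> x\<^sup>i\<close> of row \<open>i\<close>.
\<close>

lemma Delta_row_pos:
  assumes i: "1 \<le> i" "i < l"
  shows "(\<Sum>j = 0..<l. Delta_entry l p i j * corr a 0 j) =
    corr a 0 i - (\<Sum>s = 1..l. fps_const (p s) * corr a i s)"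
proof -
  let ?u = "corr a 0"
  \<comment> \<open>Here \<open>s = i - j\<close>.\<close>
  have 1: "(\<Sum>j = 1..<l. (if j < i then fps_const (p (i - j)) * fps_X ^ (i - j) else 0) * ?u j)
      = (\<Sum>s = 1..<i. fps_const (p s) * corr a i s)"
  proof -
    have "(\<Sum>s = 1..<i. fps_const (p s) * corr a i s) =
      (\<Sum>j = 1..<i. fps_const (p (i - j)) * corr a i (i - j))"
      by (rule sum.reindex_bij_witness[of _ "\<lambda>s. i - s" "\<lambda>j. i - j"]) auto
    also have "\<dots> = (\<Sum>j = 1..<i. fps_const (p (i - j)) * fps_X ^ (i - j) * ?u j)"
    proof (intro sum.cong refl)
      fix j assume "j \<in> {1..<i}"
      then show "fps_const (p (i - j)) * corr a i (i - j) = fps_const (p (i - j)) * fps_X ^ (i - j) * ?u j"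
        using corr_shift[of a "i - j" j] by (simp add: corr_commute[of a i "i - j"] mult_ac)
    qed
    also have "\<dots> = (\<Sum>j = 1..<l. (if j < i then fps_const (p (i - j)) * fps_X ^ (i - j) else 0) * ?u j)"
      using i by (intro sum.mono_neutral_cong_left) auto
    finally show ?thesis ..
  qed
  \<comment> \<open>Here \<open>s = i + j\<close>, and \<open>s \<le> l\<close> becomes the bound \<open>j \<le> l - i\<close>.\<close>
  have 2: "(\<Sum>j = 1..<l. (if j \<le> l - i then fps_const (p (i + j)) * fps_X ^ i else 0) * ?u j)
      = (\<Sum>s = Suc i..l. fps_const (p s) * corr a i s)"
  proof -
    have "(\<Sum>s = Suc i..l. fps_const (p s) * corr a i s) =
      (\<Sum>j = 1..l - i. fps_const (p (i + j)) * corr a i (i + j))"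
      by (rule sum.reindex_bij_witness[of _ "\<lambda>j. i + j" "\<lambda>s. s - i"]) auto
    also have "\<dots> = (\<Sum>j = 1..<l. (if j \<le> l - i then fps_const (p (i + j)) * fps_X ^ i else 0) * ?u j)"
      using i by (intro sum.mono_neutral_cong_left) (auto simp: corr_shift mult_ac)
    finally show ?thesis ..
  qed
  have "(\<Sum>j = 0..<l. Delta_entry l p i j * ?u j) =
      - (fps_const (p i) * fps_X ^ i) * ?u 0 + (\<Sum>j = 1..<l. Delta_entry l p i j * ?u j)"
    using i by (simp add: sum.atLeast_Suc_lessThan Delta_entry_def)
  also have "(\<Sum>j = 1..<l. Delta_entry l p i j * ?u j) =
      (\<Sum>j = 1..<l. (if i = j then 1 else 0) * ?u j
        - (if j < i then fps_const (p (i - j)) * fps_X ^ (i - j) else 0) * ?u j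
        - (if j \<le> l - i then fps_const (p (i + j)) * fps_X ^ i else 0) * ?u j)"
    using i by (intro sum.cong refl) (auto simp: Delta_entry_def algebra_simps)
  also have "\<dots> = ?u i - (\<Sum>s = 1..<i. fps_const (p s) * corr a i s)
      - (\<Sum>s = Suc i..l. fps_const (p s) * corr a i s)"
    unfolding sum_subtractf 1 2 using i by (simp add: if_distrib[of "\<lambda>z. z * _"] cong: if_cong)
  finally have *: "(\<Sum>j = 0..<l. Delta_entry l p i j * ?u j) =
     ?u i - ((\<Sum>s = 1..<i. fps_const (p s) * corr a i s) + fps_const (p i) * corr a i i
      + (\<Sum>s = Suc i..l. fps_const (p s) * corr a i s))"
    unfolding corr_self[of a i] by (simp add: mult_ac)
  have "{1..l} = insert i ({1..<i} \<union> {Suc i..l})" using i by auto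
  then have "(\<Sum>s = 1..l. fps_const (p s) * corr a i s) =
     (\<Sum>s = 1..<i. fps_const (p s) * corr a i s) + fps_const (p i) * corr a i i
      + (\<Sum>s = Suc i..l. fps_const (p s) * corr a i s)"
    by (simp, subst sum.union_disjoint) auto
  with * show ?thesis by simp
qed

theorem theorem1p1:
  fixes l :: nat and p c a :: "nat \<Rightarrow> 'a::field"
  assumes "l \<ge> 1"
    and "\<And>j. j < l \<Longrightarrow> a j = c j"
    and "\<And>n. n \<ge> l \<Longrightarrow> a n = (\<Sum>j = 1..l. p j * a (n - j))"
  shows "det (Delta_mat l p) \<noteq> 0 \<and>
    fps_to_fls (Abs_fps (\<lambda>n. (a n)\<^sup>2)) =
      fps_to_fls (det (Gamma_mat l p c)) / fps_to_fls (fps_X * det (Delta_mat l p))"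
proof
  let ?D = "Delta_mat l p" and ?A = "Abs_fps (\<lambda>n. (a n)\<^sup>2)"
  \<comment> \<open>The factor \<open>x\<close> is the one that column 0 of \<open>\<Gamma>\<close> carries.\<close>
  define u where "u = vec l (\<lambda>j. fps_X * corr a 0 j)"
  show nz: "det ?D \<noteq> 0"
    using det_Delta_nth_0[OF assms(1), of p] by auto
  have D: "?D \<in> carrier_mat l l" by (simp add: Delta_mat_def)
  have u: "u \<in> carrier_vec l" by (simp add: u_def)
  have Du: "(?D *\<^sub>v u) $ i = Gamma_entry l p c i 0" if "i < l" for i
  proof -
    have "(?D *\<^sub>v u) $ i = fps_X * (\<Sum>j = 0..<l. Delta_entry l p i j * corr a 0 j)"
      using that by (simp add: u_def Delta_mat_def scalar_prod_def sum_distrib_left mult_ac)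
    also have "\<dots> = Gamma_entry l p c i 0"
    proof (cases "i = 0")
      case True
      show ?thesis
        using trans[OF Delta_row_0[OF assms(1)] residual_square[OF assms]] True
        by (simp only: Gamma_entry_def if_True simp_thms)
    next
      case False
      then have "1 \<le> i" by simp
      then show ?thesis
        using trans[OF Delta_row_pos[OF \<open>1 \<le> i\<close> that] residual_product[OF assms \<open>1 \<le> i\<close> that]]
        by (simp add: Gamma_entry_def mult.assoc)
    qed
    finally show ?thesis .
  qed
  have "replace_col ?D (?D *\<^sub>v u) 0 = Gamma_mat l p c"
    using D Du
    by (intro eq_matI) (auto simp: replace_col_def Gamma_mat_def Delta_mat_def Gamma_entry_def)
  moreover have "u $ 0 = fps_X * ?A"
    using assms(1) by (simp add: u_def corr_def delayed_def power2_eq_square)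
  ultimately have "det (Gamma_mat l p c) = ?A * (fps_X * det ?D)"
    using cramer_lemma_mat[OF D u, of 0] assms(1) by (simp add: mult_ac)
  then show "fps_to_fls ?A =
      fps_to_fls (det (Gamma_mat l p c)) / fps_to_fls (fps_X * det ?D)"
    using nz by (simp add: fls_times_fps_to_fls)
qed
end
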